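(* Let $n,k\ge1$, let $K\subseteq\mathbb{R}^n$ be a closed set, and let $y\in\mathcal{M}_{n,k}$. The following are equivalent: (i) the Riesz functional $L_y$ is $K$-positive; (ii) $y\in\overline{\mathcal{F}_{n,k}(K)}$; (iii) $y\in\overline{\mathcal{R}_{n,k}(K)}$.
   Context: $\mathbb{Z}_+$ is the set of nonnegative integers; for $\alpha\in\mathbb{Z}_+^n$, $|\alpha|=\alpha_1+\cdots+\alpha_n$ and $x^\alpha=x_1^{\alpha_1}\cdots x_n^{\alpha_n}$. $\mathcal{M}_{n,k}$ is the set of all real families $y=(y_\alpha)_{\alpha\in\mathbb{Z}_+^n,|\alpha|\le k}$, identified with $\mathbb{R}^\eta$, $\eta=\binom{n+k}{k}$, with its usual Euclidean topology; overlines denote closure in this space. $\mathcal{P}_k$ is the space of real polynomials in $x_1,\dots,x_n$ of degree at most $k$. The Riesz functional $L_y:\mathcal{P}_k\to\mathbb{R}$ is $L_y\big(\sum_{|\alpha|\le k}p_\alpha x^\alpha\big)=\sum_{|\alpha|\le k}p_\alpha y_\alpha$; it is $K$-positive if $L_y(p)\ge 0$ for every $p\in\mathcal{P}_k$ with $p|_K\ge0$. A $K$-representing measure for $y$ is a positive Borel measure $\mu$ on $\mathbb{R}^n$, supported in $K$, with $y_\alpha=\int x^\alpha\,d\mu(x)$ for all $|\alpha|\le k$. $\mathcal{R}_{n,k}(K)$ is the set of $y\in\mathcal{M}_{n,k}$ having a $K$-representing measure, and $\mathcal{F}_{n,k}(K)$ is the set of $y\in\mathcal{M}_{n,k}$ having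 a finitely atomic $K$-representing measure (a finite sum of positive multiples of point masses). *)

theory Defs
  imports "HOL-Analysis.Analysis" "HOL-Library.Poly_Mapping"
begin

text \<open>The dimension is \<open>n = CARD('n)\<close>, and multi-indices are elements of \<^typ>\<open>nat ^ 'n\<close>.\<close>

definition multi_indices :: "nat \<Rightarrow> (nat ^ 'n) set"
  where "multi_indices k = {\<alpha>. (\<Sum>i\<in>UNIV. \<alpha> $ i) \<le> k}"

definition mpower :: "real ^ 'n \<Rightarrow> nat ^ 'n \<Rightarrow> real"
  where "mpower x \<alpha> = (\<Prod>i\<in>UNIV. (x $ i) ^ (\<alpha> $ i))"

text \<open>Families indexed by \<open>multi_indices k\<close> are functions that are \<^const>\<open>undefined\<close> at all other
  multi-indices. As \<open>multi_indices k\<close> is finite, the product topology is the Euclidean one.\<close>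

definition moment_topology :: "nat \<Rightarrow> (nat ^ 'n \<Rightarrow> real) topology"
  where "moment_topology k = product_topology (\<lambda>_. euclideanreal) (multi_indices k)"

definition moment_space :: "nat \<Rightarrow> (nat ^ 'n \<Rightarrow> real) set"
  where "moment_space k = (\<Pi>\<^sub>E \<alpha>\<in>multi_indices k. UNIV)"

text \<open>A real polynomial in \<open>n\<close> variables is its finitely supported coefficient function.\<close>

type_synonym 'n mpolynomial = "(nat ^ 'n) \<Rightarrow>\<^sub>0 real"

definition mpolys :: "nat \<Rightarrow> 'n::finite mpolynomial set"
  where "mpolys k = {p. Poly_Mapping.keys p \<subseteq> multi_indices k}"

definition mpoly_eval :: "'n::finite mpolynomial \<Rightarrow> real ^ 'n \<Rightarrow> real"
  where "mpoly_eval p x = (\<Sum>\<alpha>\<in>Poly_Mapping.keys p. Poly_Mapping.lookup p \<alpha> * mpower x \<alpha>)"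

definition riesz :: "nat \<Rightarrow> (nat ^ 'n \<Rightarrow> real) \<Rightarrow> 'n::finite mpolynomial \<Rightarrow> real"
  where "riesz k y p = (\<Sum>\<alpha>\<in>multi_indices k. Poly_Mapping.lookup p \<alpha> * y \<alpha>)"

definition K_positive :: "nat \<Rightarrow> (real ^ 'n) set \<Rightarrow> ('n::finite mpolynomial \<Rightarrow> real) \<Rightarrow> bool"
  where "K_positive k K L \<longleftrightarrow> (\<forall>p\<in>mpolys k. (\<forall>x\<in>K. 0 \<le> mpoly_eval p x) \<longrightarrow> 0 \<le> L p)"

text \<open>Integrability of the monomials is required explicitly because \<^const>\<open>lebesgue_integral\<close> is
  \<open>0\<close> on functions that are not integrable. For closed \<open>K\<close>, a Borel measure has its support
  contained in \<open>K\<close> iff the complement of \<open>K\<close> is a null set.\<close>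

definition representing_measure ::
    "nat \<Rightarrow> (real ^ 'n) set \<Rightarrow> (nat ^ 'n \<Rightarrow> real) \<Rightarrow> (real ^ 'n) measure \<Rightarrow> bool"
  where "representing_measure k K y \<mu> \<longleftrightarrow>
    sets \<mu> = sets borel \<and> emeasure \<mu> (- K) = 0 \<and>
    (\<forall>\<alpha>\<in>multi_indices k. integrable \<mu> (\<lambda>x. mpower x \<alpha>) \<and>
       y \<alpha> = (\<integral>x. mpower x \<alpha> \<partial>\<mu>))"

text \<open>The empty set of atoms is allowed: the zero measure is the empty sum of point masses.\<close>

definition finitely_atomic :: "(real ^ 'n) measure \<Rightarrow> bool"
  where "finitely_atomic \<mu> \<longleftrightarrow> sets \<mu> = sets borel \<and>
    (\<exists>S c. finite S \<and> (\<forall>x\<in>S. (0::real) < c x) \<and>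
       (\<forall>A\<in>sets borel. emeasure \<mu> A = (\<Sum>x\<in>S. ennreal (c x) * indicator A x)))"

definition representable :: "nat \<Rightarrow> (real ^ 'n) set \<Rightarrow> (nat ^ 'n \<Rightarrow> real) set"
  where "representable k K = {y \<in> moment_space k. \<exists>\<mu>. representing_measure k K y \<mu>}"

definition atomic_representable :: "nat \<Rightarrow> (real ^ 'n) set \<Rightarrow> (nat ^ 'n \<Rightarrow> real) set"
  where "atomic_representable k K =
    {y \<in> moment_space k. \<exists>\<mu>. representing_measure k K y \<mu> \<and> finitely_atomic \<mu>}"

end

theory Submission
  imports Defs
begin

text \<open>
  The moment sequences of finitely atomic measures on \<open>K\<close> form a convex cone, generated by the
  vectors \<open>(x\<^sup>\<alpha>)\<^sub>\<alpha>\<close> with \<open>x \<in> K\<close>, and the polynomials of degree at most \<open>k\<close> are exactly the linear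
  functionals on the moment space, a polynomial \<open>p\<close> acting by \<open>y \<mapsto> L\<^sub>y(p)\<close>. Since \<open>L\<^sub>y(p) = p(x)\<close> when
  \<open>y = (x\<^sup>\<alpha>)\<^sub>\<alpha>\<close>, the functionals that are nonnegative on the cone are the polynomials that are
  nonnegative on \<open>K\<close>. So \<open>K\<close>-positivity of \<open>L\<^sub>y\<close> says that \<open>y\<close> lies in the bidual of the cone, and
  the bidual of a convex cone in finite dimension is its closure. This last fact is the
  separation lemma \<open>separate_point_from_convex_cone\<close>; it yields (i) \<open>\<Longrightarrow>\<close> (ii)
  in \<open>K_positive_imp_in_closure\<close>.

  Finitely atomic measures are measures, hence (ii) \<open>\<Longrightarrow>\<close> (iii). For (iii) \<open>\<Longrightarrow>\<close> (i), integration
  of a nonnegative polynomial shows \<open>L\<^sub>z(p) \<ge> 0\<close> for every representable \<open>z\<close>, and this inequality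
  is preserved under limits of \<open>z\<close> because \<open>L\<^sub>z(p)\<close> is a finite linear combination of coordinates
  of \<open>z\<close>.
\<close>

section \<open>Separating a point from a convex cone\<close>

lemma in_closure_of_finite_product:
  fixes y :: "'i \<Rightarrow> real"
  assumes fin: "finite I" and y: "y \<in> (\<Pi>\<^sub>E i\<in>I. UNIV)" and C: "C \<subseteq> (\<Pi>\<^sub>E i\<in>I. UNIV)"
    and approx: "\<And>e. e > 0 \<Longrightarrow> \<exists>z\<in>C. \<forall>i\<in>I. \<bar>z i - y i\<bar> < e"
  shows "y \<in> product_topology (\<lambda>_. euclideanreal) I closure_of C"
  unfolding in_closure_of
proof (intro conjI allI impI)
  show "y \<in> topspace (product_topology (\<lambda>_. euclideanreal) I)"
    using y by simp
next
  fix T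
  assume "y \<in> T \<and> openin (product_topology (\<lambda>_. euclideanreal) I) T"
  then obtain U where U: "\<forall>i\<in>I. open (U i)" "y \<in> Pi\<^sub>E I U" "Pi\<^sub>E I U \<subseteq> T"
    by (auto simp: openin_product_topology_alt)
  have "\<forall>i\<in>I. \<exists>r>0. ball (y i) r \<subseteq> U i"
    using U(1,2) by (metis PiE_mem open_contains_ball_eq)
  then obtain r where r: "\<And>i. i \<in> I \<Longrightarrow> r i > 0 \<and> ball (y i) (r i) \<subseteq> U i"
    by metis
  define e where "e = Min (insert 1 (r ` I))"
  have "e > 0"
    using fin r by (auto simp: e_def)
  then obtain z where z: "z \<in> C" "\<forall>i\<in>I. \<bar>z i - y i\<bar> < e"
    using approx by blast
  have "z i \<in> U i" if "i \<in> I" for i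
  proof -
    have "e \<le> r i"
      using fin that by (auto simp: e_def intro: Min_le)
    then have "z i \<in> ball (y i) (r i)"
      using z(2) that by (fastforce simp: dist_real_def)
    then show ?thesis
      using r[OF that] by blast
  qed
  then have "z \<in> Pi\<^sub>E I U"
    using subsetD[OF C z(1)] by (simp add: PiE_iff)
  then show "\<exists>z. z \<in> C \<and> z \<in> T"
    using z(1) U(3) by blast
qed

text \<open>
  The first-order condition at a minimum: dividing by \<open>2 * t\<close> and letting \<open>t\<close> tend to \<open>0\<close> leaves
  only the linear coefficient.
\<close>

lemma first_order_nonneg:
  fixes P Q :: real
  assumes "0 \<le> Q" and "\<And>t. 0 < t \<Longrightarrow> t < 1 \<Longrightarrow> 0 \<le> 2 * t * P + t\<^sup>2 * Q"
  shows "0 \<le> P"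
proof (rule ccontr)
  assume "\<not> 0 \<le> P"
  define t where "t = min (1/2) (- P / (Q + 1))"
  have t: "0 < t" "t < 1"
    using \<open>\<not> 0 \<le> P\<close> \<open>0 \<le> Q\<close> by (auto simp: t_def divide_neg_pos)
  have "t * (Q + 1) \<le> - P"
  proof -
    have "t \<le> - P / (Q + 1)"
      by (simp add: t_def)
    then show ?thesis
      using pos_le_divide_eq[of "Q + 1" t "- P"] \<open>0 \<le> Q\<close> by linarith
  qed
  then have "2 * P + t * Q < 0"
    using t \<open>\<not> 0 \<le> P\<close> by (simp add: algebra_simps)
  then have "t * (2 * P + t * Q) < 0"
    using t by (simp add: mult_pos_neg)
  then show False
    using assms(2)[OF t] by (simp add: power2_eq_square algebra_simps)
qed

text \<open>
  The functional is \<open>p = a - y\<close>, where \<open>a\<close> is the point of the closure of \<open>C\<close> nearest to \<open>y\<close>.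
  It exists because a minimising sequence is Cauchy by the parallelogram law. Moving from
  \<open>a\<close> in a direction \<open>c \<in> C\<close>, or towards the origin, does not decrease the distance, whence
  \<open>\<langle>p, c\<rangle> \<ge> 0\<close> and \<open>\<langle>p, a\<rangle> \<le> 0\<close>, so that \<open>\<langle>p, y\<rangle> = \<langle>p, a\<rangle> - \<parallel>p\<parallel>\<^sup>2 < 0\<close>.
\<close>

lemma separate_point_from_convex_cone:
  fixes y :: "'i \<Rightarrow> real"
  assumes fin: "finite I" and y: "y \<in> (\<Pi>\<^sub>E i\<in>I. UNIV)" and C: "C \<subseteq> (\<Pi>\<^sub>E i\<in>I. UNIV)"
    and ne: "C \<noteq> {}"
    and add: "\<And>u v. u \<in> C \<Longrightarrow> v \<in> C \<Longrightarrow> (\<lambda>i\<in>I. u i + v i) \<in> C"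
    and scale: "\<And>t u. t > 0 \<Longrightarrow> u \<in> C \<Longrightarrow> (\<lambda>i\<in>I. t * u i) \<in> C"
    and nin: "y \<notin> product_topology (\<lambda>_. euclideanreal) I closure_of C"
  obtains p where "\<And>c. c \<in> C \<Longrightarrow> 0 \<le> (\<Sum>i\<in>I. p i * c i)" and "(\<Sum>i\<in>I. p i * y i) < 0"
proof -
  define d where "d z = (\<Sum>i\<in>I. (z i - y i)\<^sup>2)" for z
  define m where "m = Inf (d ` C)"
  have d_nonneg: "0 \<le> d z" for z
    by (simp add: d_def sum_nonneg)
  have d_cong: "d (restrict z I) = d z" for z
    by (simp add: d_def)
  have m_le: "m \<le> d z" if "z \<in> C" for z
    unfolding m_def using that d_nonneg by (intro cInf_lower bdd_belowI[of _ 0]) auto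

  have "m > 0"
  proof -
    obtain e where e: "e > 0" "\<And>z. z \<in> C \<Longrightarrow> \<exists>i\<in>I. \<not> \<bar>z i - y i\<bar> < e"
      using in_closure_of_finite_product[OF fin y C] nin by blast
    have "e\<^sup>2 \<le> d z" if z: "z \<in> C" for z
    proof -
      obtain i where i: "i \<in> I" "e \<le> \<bar>z i - y i\<bar>"
        using e(2)[OF z] by force
      then have "e\<^sup>2 \<le> (z i - y i)\<^sup>2"
        using e(1) by (metis abs_le_square_iff abs_of_pos)
      also have "\<dots> \<le> d z"
        unfolding d_def using i fin by (intro member_le_sum) auto
      finally show ?thesis .
    qed
    then have "e\<^sup>2 \<le> m"
      unfolding m_def using ne by (intro cINF_greatest) auto
    then show ?thesis
      using e(1) by (meson less_le_trans zero_less_power)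
  qed

  have "\<exists>z\<in>C. d z < m + inverse (real (Suc n))" for n
  proof -
    have "Inf (d ` C) < m + inverse (real (Suc n))"
      by (simp add: m_def)
    then show ?thesis
      using cInf_lessD[of "d ` C"] ne by blast
  qed
  then obtain z where z: "\<And>n. z n \<in> C" "\<And>n. d (z n) < m + inverse (real (Suc n))"
    by metis

  \<comment> \<open>The midpoint of \<open>z j\<close> and \<open>z n\<close> lies in \<open>C\<close>, so its squared distance from \<open>y\<close> is at least \<open>m\<close>.\<close>
  have parallelogram: "(\<Sum>i\<in>I. (z j i - z n i)\<^sup>2)
      \<le> 2 * inverse (real (Suc j)) + 2 * inverse (real (Suc n))" for j n
  proof -
    define w where "w = (\<lambda>i. 1/2 * (z j i + z n i))"
    have "(\<lambda>i\<in>I. 1/2 * (\<lambda>i\<in>I. z j i + z n i) i) \<in> C"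
      by (intro scale add z) simp
    moreover have "(\<lambda>i\<in>I. 1/2 * (\<lambda>i\<in>I. z j i + z n i) i) = restrict w I"
      by (auto simp: w_def restrict_def)
    ultimately have "m \<le> d w"
      using m_le d_cong by metis
    moreover have "(\<Sum>i\<in>I. (z j i - z n i)\<^sup>2) = 2 * d (z j) + 2 * d (z n) - 4 * d w"
      unfolding d_def w_def sum_distrib_left sum.distrib[symmetric] sum_subtractf[symmetric]
      by (intro sum.cong) (auto simp: power2_eq_square field_simps)
    ultimately show ?thesis
      using z(2)[of j] z(2)[of n] by simp
  qed
  have "Cauchy (\<lambda>n. z n i)" if i: "i \<in> I" for i
    unfolding Cauchy_def
  proof (intro allI impI)
    fix e :: real
    assume "e > 0"
    obtain N where N: "inverse (real (Suc N)) < e\<^sup>2 / 4"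
      using reals_Archimedean[of "e\<^sup>2 / 4"] \<open>e > 0\<close> by auto
    have "dist (z j i) (z n i) < e" if "j \<ge> N" "n \<ge> N" for j n
    proof -
      have "(z j i - z n i)\<^sup>2 \<le> (\<Sum>i\<in>I. (z j i - z n i)\<^sup>2)"
        using i fin by (intro member_le_sum) auto
      also have "\<dots> \<le> 2 * inverse (real (Suc j)) + 2 * inverse (real (Suc n))"
        by (rule parallelogram)
      also have "\<dots> \<le> 4 * inverse (real (Suc N))"
        using le_imp_inverse_le[of "real (Suc N)" "real (Suc j)"]
          le_imp_inverse_le[of "real (Suc N)" "real (Suc n)"] that by linarith
      also have "\<dots> < e\<^sup>2"
        using N by simp
      finally have "\<bar>z j i - z n i\<bar>\<^sup>2 < e\<^sup>2"
        by simp
      then show ?thesis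
        using \<open>e > 0\<close> by (simp add: dist_real_def power2_less_imp_less)
    qed
    then show "\<exists>N. \<forall>j\<ge>N. \<forall>n\<ge>N. dist (z j i) (z n i) < e"
      by blast
  qed
  then have "\<forall>i\<in>I. \<exists>l. (\<lambda>n. z n i) \<longlonglongrightarrow> l"
    by (simp add: Cauchy_convergent_iff convergent_def)
  then obtain a where a: "\<And>i. i \<in> I \<Longrightarrow> (\<lambda>n. z n i) \<longlonglongrightarrow> a i"
    by metis

  have "(\<lambda>n. d (z n)) \<longlonglongrightarrow> d a"
    unfolding d_def by (intro tendsto_intros a)
  moreover have "(\<lambda>n. d (z n)) \<longlonglongrightarrow> m"
  proof (rule tendsto_sandwich[OF _ _ tendsto_const])
    show "(\<lambda>n. m + inverse (real (Suc n))) \<longlonglongrightarrow> m"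
      using tendsto_add[OF tendsto_const LIMSEQ_inverse_real_of_nat, of m] by simp
    show "\<forall>\<^sub>F n in sequentially. m \<le> d (z n)"
      by (intro always_eventually allI m_le z)
    show "\<forall>\<^sub>F n in sequentially. d (z n) \<le> m + inverse (real (Suc n))"
      by (intro always_eventually allI less_imp_le z)
  qed
  ultimately have da: "d a = m"
    using LIMSEQ_unique by blast

  define p where "p = (\<lambda>i. a i - y i)"
  have expand: "d (\<lambda>i. a i + t * w i) = m + 2 * t * (\<Sum>i\<in>I. p i * w i) + t\<^sup>2 * (\<Sum>i\<in>I. (w i)\<^sup>2)"
    for t w
    unfolding da[symmetric] unfolding d_def p_def sum_distrib_left sum.distrib[symmetric]
    by (intro sum.cong) (auto simp: power2_eq_square algebra_simps)

  \<comment> \<open>The point \<open>a\<close> itself need not belong to \<open>C\<close>, so the bound \<open>m\<close> is first obtained along the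
    sequence \<open>z\<close> and then passes to the limit.\<close>
  have nonneg: "0 \<le> (\<Sum>i\<in>I. p i * c i)" if c: "c \<in> C" for c
  proof (rule first_order_nonneg)
    fix t :: real
    assume "0 < t" "t < 1"
    have "m \<le> d (\<lambda>i. z n i + t * c i)" for n
    proof -
      have "(\<lambda>i\<in>I. z n i + (\<lambda>i\<in>I. t * c i) i) \<in> C"
        by (intro add scale z c \<open>0 < t\<close>)
      then have "(\<lambda>i\<in>I. z n i + t * c i) \<in> C"
        by (simp cong: restrict_cong)
      then show ?thesis
        using m_le d_cong by metis
    qed
    moreover have "(\<lambda>n. d (\<lambda>i. z n i + t * c i)) \<longlonglongrightarrow> d (\<lambda>i. a i + t * c i)"
      unfolding d_def by (intro tendsto_intros a)
    ultimately have "m \<le> d (\<lambda>i. a i + t * c i)"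
      by (intro LIMSEQ_le_const) auto
    then show "0 \<le> 2 * t * (\<Sum>i\<in>I. p i * c i) + t\<^sup>2 * (\<Sum>i\<in>I. (c i)\<^sup>2)"
      by (simp add: expand)
  qed (simp add: sum_nonneg)

  have "0 \<le> (\<Sum>i\<in>I. p i * - a i)"
  proof (rule first_order_nonneg)
    fix t :: real
    assume "0 < t" "t < 1"
    have "m \<le> d (\<lambda>i. z n i + t * - z n i)" for n
    proof -
      have "(\<lambda>i\<in>I. (1 - t) * z n i) \<in> C"
        using \<open>t < 1\<close> by (intro scale z) simp
      then have "(\<lambda>i\<in>I. z n i + t * - z n i) \<in> C"
        by (simp add: algebra_simps)
      then show ?thesis
        using m_le d_cong by metis
    qed
    moreover have "(\<lambda>n. d (\<lambda>i. z n i + t * - z n i)) \<longlonglongrightarrow> d (\<lambda>i. a i + t * - a i)"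
      unfolding d_def by (intro tendsto_intros a)
    ultimately have "m \<le> d (\<lambda>i. a i + t * - a i)"
      by (intro LIMSEQ_le_const) auto
    then show "0 \<le> 2 * t * (\<Sum>i\<in>I. p i * - a i) + t\<^sup>2 * (\<Sum>i\<in>I. (- a i)\<^sup>2)"
      by (subst (asm) expand) simp
  qed (simp add: sum_nonneg)
  moreover have "(\<Sum>i\<in>I. p i * y i) = - (\<Sum>i\<in>I. p i * - a i) - d a"
    unfolding d_def p_def sum_subtractf[symmetric] sum_negf[symmetric]
    by (intro sum.cong) (auto simp: power2_eq_square algebra_simps)
  ultimately have "(\<Sum>i\<in>I. p i * y i) < 0"
    using da \<open>m > 0\<close> by simp
  with nonneg show ?thesis
    by (rule that)
qed

section \<open>Polynomials as linear functionals on the moment space\<close>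

lemma finite_multi_indices: "finite (multi_indices k :: (nat ^ 'n) set)"
proof (rule finite_subset)
  show "multi_indices k \<subseteq> vec_lambda ` ((UNIV :: 'n set) \<rightarrow>\<^sub>E {..k})"
  proof
    fix \<alpha> :: "nat ^ 'n"
    assume "\<alpha> \<in> multi_indices k"
    then have "\<alpha> $ i \<le> k" for i
      using member_le_sum[of i UNIV "\<lambda>i. \<alpha> $ i"] by (fastforce simp: multi_indices_def)
    then have "vec_nth \<alpha> \<in> UNIV \<rightarrow>\<^sub>E {..k}"
      by auto
    then show "\<alpha> \<in> vec_lambda ` ((UNIV :: 'n set) \<rightarrow>\<^sub>E {..k})"
      by (metis imageI vec_nth_inverse)
  qed
  show "finite (vec_lambda ` ((UNIV :: 'n set) \<rightarrow>\<^sub>E {..k}))"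
    by (intro finite_imageI finite_PiE) auto
qed

lemma mpoly_eval_eq_sum_multi_indices:
  assumes "p \<in> mpolys k"
  shows "mpoly_eval p x = (\<Sum>\<alpha>\<in>multi_indices k. Poly_Mapping.lookup p \<alpha> * mpower x \<alpha>)"
  unfolding mpoly_eval_def using assms
  by (intro sum.mono_neutral_left) (auto simp: finite_multi_indices mpolys_def in_keys_iff)

lemma obtain_mpoly_with_coefficients:
  fixes q :: "nat ^ 'n \<Rightarrow> real"
  obtains p where "p \<in> mpolys k" "\<And>\<alpha>. \<alpha> \<in> multi_indices k \<Longrightarrow> Poly_Mapping.lookup p \<alpha> = q \<alpha>"
proof -
  define p where "p = Abs_poly_mapping (\<lambda>\<alpha>. if \<alpha> \<in> multi_indices k then q \<alpha> else 0)"
  have "finite {\<alpha>. (if \<alpha> \<in> multi_indices k then q \<alpha> else 0) \<noteq> 0}"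
    by (rule finite_subset[OF _ finite_multi_indices[of k]]) auto
  then have "Poly_Mapping.lookup p = (\<lambda>\<alpha>. if \<alpha> \<in> multi_indices k then q \<alpha> else 0)"
    by (simp add: p_def)
  then show ?thesis
    by (intro that[of p]) (auto simp: mpolys_def in_keys_iff split: if_splits)
qed

lemma topspace_moment_topology: "topspace (moment_topology k) = moment_space k"
  by (simp add: moment_topology_def moment_space_def)

lemma continuous_map_riesz:
  "continuous_map (moment_topology k) euclideanreal (\<lambda>z. riesz k z p)"
  unfolding riesz_def moment_topology_def
  by (intro continuous_map_sum finite_multi_indices continuous_map_real_mult
      continuous_map_product_projection) auto

section \<open>Measures give positive functionals\<close>

lemma K_positive_of_representing_measure:
  assumes "closed K" and "representing_measure k K z \<mu>"
  shows "K_positive k K (riesz k z)"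
  unfolding K_positive_def
proof (intro ballI impI)
  fix p
  assume p: "p \<in> mpolys k" and pos: "\<forall>x\<in>K. 0 \<le> mpoly_eval p x"
  have sets: "sets \<mu> = sets borel" and null: "emeasure \<mu> (- K) = 0"
    and int: "\<And>\<alpha>. \<alpha> \<in> multi_indices k \<Longrightarrow> integrable \<mu> (\<lambda>x. mpower x \<alpha>)"
    and z: "\<And>\<alpha>. \<alpha> \<in> multi_indices k \<Longrightarrow> z \<alpha> = (\<integral>x. mpower x \<alpha> \<partial>\<mu>)"
    using assms by (auto simp: representing_measure_def)
  have "riesz k z p = (\<integral>x. mpoly_eval p x \<partial>\<mu>)"
    using int by (simp add: mpoly_eval_eq_sum_multi_indices[OF p] riesz_def z)
  moreover have "AE x in \<mu>. 0 \<le> mpoly_eval p x"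
    \<comment> \<open>Closedness of \<open>K\<close> makes \<open>- K\<close> measurable, so that it really is a null set and \<open>emeasure\<close>
      does not vanish on it merely by default.\<close>
    using null pos sets \<open>closed K\<close> by (intro AE_I[of _ _ "- K"]) auto
  ultimately show "0 \<le> riesz k z p"
    by (simp add: integral_nonneg_AE)
qed

lemma K_positive_if_in_closure:
  fixes K :: "(real ^ 'n) set"
  assumes "closed K" and "y \<in> moment_topology k closure_of representable k K"
  shows "K_positive k K (riesz k y)"
  unfolding K_positive_def
proof (intro ballI impI)
  fix p :: "'n mpolynomial"
  assume p: "p \<in> mpolys k" "\<forall>x\<in>K. 0 \<le> mpoly_eval p x"
  let ?H = "{z \<in> topspace (moment_topology k). riesz k z p \<in> {0..}}"
  have "representable k K \<subseteq> ?H"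
  proof
    fix z
    assume "z \<in> representable k K"
    then obtain \<mu> where z: "z \<in> moment_space k" and \<mu>: "representing_measure k K z \<mu>"
      by (auto simp: representable_def)
    have "0 \<le> riesz k z p"
      using K_positive_of_representing_measure[OF \<open>closed K\<close> \<mu>] p
      by (auto simp: K_positive_def)
    then show "z \<in> ?H"
      using z by (simp add: topspace_moment_topology)
  qed
  moreover have "closedin (moment_topology k) ?H"
    by (rule closedin_continuous_map_preimage[OF continuous_map_riesz]) simp
  ultimately have "moment_topology k closure_of representable k K \<subseteq> ?H"
    by (rule closure_of_minimal)
  with assms(2) have "y \<in> ?H"
    by (rule rev_subsetD)
  then show "0 \<le> riesz k y p"
    by simp
qed

section \<open>Positive functionals are limits of atomic measures\<close>

definition atomic_moments :: "nat \<Rightarrow> (real ^ 'n) set \<Rightarrow> (real ^ 'n \<Rightarrow> real) \<Rightarrow> (nat ^ 'n \<Rightarrow> real)"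
  where "atomic_moments k S c = (\<lambda>\<alpha>\<in>multi_indices k. \<Sum>x\<in>S. c x * mpower x \<alpha>)"

definition atomic_cone :: "nat \<Rightarrow> (real ^ 'n) set \<Rightarrow> (nat ^ 'n \<Rightarrow> real) set"
  where "atomic_cone k K =
    {atomic_moments k S c | S c. finite S \<and> S \<subseteq> K \<and> (\<forall>x\<in>S. 0 < c x)}"

lemma atomic_cone_subset_moment_space: "atomic_cone k K \<subseteq> moment_space k"
  by (auto simp: atomic_cone_def atomic_moments_def moment_space_def)

text \<open>
  A finitely supported weighted sum of point masses is obtained by pushing a weighted counting
  measure on \<open>S\<close>, in which every subset is measurable, forward to the Borel space.
\<close>

lemma atomic_cone_subset_atomic_representable:
  fixes K :: "(real ^ 'n) set"
  shows "atomic_cone k K \<subseteq> atomic_representable k K"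
proof
  fix z
  assume "z \<in> atomic_cone k K"
  then obtain S c where S: "finite S" "S \<subseteq> K" and c: "\<forall>x\<in>S. 0 < c x"
    and z: "z = atomic_moments k S c"
    by (auto simp: atomic_cone_def)
  define \<nu> where "\<nu> = point_measure S (\<lambda>x. ennreal (c x))"
  define \<mu> where "\<mu> = distr \<nu> borel (\<lambda>x. x)"
  have sets: "sets \<mu> = sets borel"
    by (simp add: \<mu>_def)
  have meas: "(\<lambda>x. x) \<in> measurable \<nu> borel"
    by (simp add: \<nu>_def measurable_point_measure_eq1)
  have emeasure: "emeasure \<mu> A = (\<Sum>x\<in>S. ennreal (c x) * indicator A x)"
    if "A \<in> sets borel" for A
  proof -
    have "emeasure \<mu> A = emeasure \<nu> (A \<inter> S)"
      using that meas by (simp add: \<mu>_def emeasure_distr) (simp add: \<nu>_def space_point_measure)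
    also have "\<dots> = (\<Sum>x\<in>A \<inter> S. ennreal (c x))"
      unfolding \<nu>_def using S by (intro emeasure_point_measure_finite) auto
    also have "\<dots> = (\<Sum>x\<in>S. ennreal (c x) * indicator A x)"
      using S by (simp add: sum.inter_restrict Int_commute indicator_def if_distrib cong: if_cong)
    finally show ?thesis .
  qed
  have "emeasure \<mu> (- K) = 0"
  proof (cases "- K \<in> sets borel")
    case True
    then show ?thesis
      using emeasure[OF True] S by (auto simp: indicator_def intro!: sum.neutral)
  next
    case False
    then show ?thesis
      by (simp add: emeasure_notin_sets sets)
  qed
  have mpower_meas: "(\<lambda>x. mpower x \<alpha>) \<in> borel_measurable borel" for \<alpha> :: "nat ^ 'n"
    unfolding mpower_def by measurable
  have "integrable \<mu> (\<lambda>x. mpower x \<alpha>)" for \<alpha>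
    unfolding \<mu>_def by (subst integrable_distr_eq[OF meas mpower_meas])
      (simp add: \<nu>_def integrable_point_measure_finite S)
  moreover have "(\<integral>x. mpower x \<alpha> \<partial>\<mu>) = (\<Sum>x\<in>S. c x * mpower x \<alpha>)" for \<alpha>
    unfolding \<mu>_def using S c
    by (subst integral_distr[OF meas mpower_meas])
      (simp add: \<nu>_def lebesgue_integral_point_measure_finite less_imp_le)
  ultimately have "representing_measure k K z \<mu>"
    using sets \<open>emeasure \<mu> (- K) = 0\<close>
    by (simp add: representing_measure_def z atomic_moments_def)
  moreover have "finitely_atomic \<mu>"
    using sets S c emeasure unfolding finitely_atomic_def by blast
  moreover have "z \<in> moment_space k"
    by (simp add: z atomic_moments_def moment_space_def)
  ultimately show "z \<in> atomic_representable k K"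
    by (auto simp: atomic_representable_def)
qed

lemma atomic_cone_add:
  assumes "u \<in> atomic_cone k K" "v \<in> atomic_cone k K"
  shows "(\<lambda>\<alpha>\<in>multi_indices k. u \<alpha> + v \<alpha>) \<in> atomic_cone k K"
proof -
  obtain S c where S: "finite S" "S \<subseteq> K" "\<forall>x\<in>S. 0 < c x" and u: "u = atomic_moments k S c"
    using assms(1) by (auto simp: atomic_cone_def)
  obtain T b where T: "finite T" "T \<subseteq> K" "\<forall>x\<in>T. 0 < b x" and v: "v = atomic_moments k T b"
    using assms(2) by (auto simp: atomic_cone_def)
  define a where "a x = (if x \<in> S then c x else 0) + (if x \<in> T then b x else 0)" for x
  have "(\<Sum>x\<in>S \<union> T. a x * mpower x \<alpha>)
      = (\<Sum>x\<in>S. c x * mpower x \<alpha>) + (\<Sum>x\<in>T. b x * mpower x \<alpha>)" for \<alpha>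
  proof -
    have "(\<Sum>x\<in>S. c x * mpower x \<alpha>) = (\<Sum>x\<in>S \<union> T. (if x \<in> S then c x else 0) * mpower x \<alpha>)"
      using S T by (intro sum.mono_neutral_cong_left) auto
    moreover have "(\<Sum>x\<in>T. b x * mpower x \<alpha>) = (\<Sum>x\<in>S \<union> T. (if x \<in> T then b x else 0) * mpower x \<alpha>)"
      using S T by (intro sum.mono_neutral_cong_left) auto
    ultimately show ?thesis
      by (simp add: a_def distrib_right sum.distrib)
  qed
  then have "(\<lambda>\<alpha>\<in>multi_indices k. u \<alpha> + v \<alpha>) = atomic_moments k (S \<union> T) a"
    by (auto simp: u v atomic_moments_def restrict_def)
  moreover have "\<forall>x\<in>S \<union> T. 0 < a x"
    using S T by (auto simp: a_def add_pos_pos)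
  ultimately show ?thesis
    using S T unfolding atomic_cone_def by blast
qed

lemma atomic_cone_scale:
  assumes "0 < t" "u \<in> atomic_cone k K"
  shows "(\<lambda>\<alpha>\<in>multi_indices k. t * u \<alpha>) \<in> atomic_cone k K"
proof -
  obtain S c where S: "finite S" "S \<subseteq> K" "\<forall>x\<in>S. 0 < c x" and u: "u = atomic_moments k S c"
    using assms(2) by (auto simp: atomic_cone_def)
  have "(\<lambda>\<alpha>\<in>multi_indices k. t * u \<alpha>) = atomic_moments k S (\<lambda>x. t * c x)"
    by (auto simp: u atomic_moments_def restrict_def sum_distrib_left mult.assoc)
  moreover have "\<forall>x\<in>S. 0 < t * c x"
    using S assms(1) by simp
  ultimately show ?thesis
    using S unfolding atomic_cone_def by blast
qed

text \<open>
  A functional that separates \<open>y\<close> from the cone is a polynomial \<open>p\<close> with \<open>L\<^sub>y(p) < 0\<close>.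
  Its values on the generators of the cone are the values of \<open>p\<close> on \<open>K\<close>, so \<open>p\<close> is a witness
  against \<open>K\<close>-positivity.
\<close>

lemma K_positive_imp_in_closure:
  fixes K :: "(real ^ 'n) set"
  assumes pos: "K_positive k K (riesz k y)" and y: "y \<in> moment_space k"
  shows "y \<in> moment_topology k closure_of atomic_cone k K"
proof (rule ccontr)
  assume nin: "y \<notin> moment_topology k closure_of atomic_cone k K"
  have "atomic_moments k {} (\<lambda>_. 1) \<in> atomic_cone k K"
    unfolding atomic_cone_def by blast
  then have ne: "atomic_cone k K \<noteq> {}"
    by blast
  obtain q where q: "\<And>c. c \<in> atomic_cone k K \<Longrightarrow> 0 \<le> (\<Sum>\<alpha>\<in>multi_indices k. q \<alpha> * c \<alpha>)"
    and qy: "(\<Sum>\<alpha>\<in>multi_indices k. q \<alpha> * y \<alpha>) < 0"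
    using separate_point_from_convex_cone[OF finite_multi_indices
        y[unfolded moment_space_def] atomic_cone_subset_moment_space[unfolded moment_space_def]
        ne atomic_cone_add atomic_cone_scale nin[unfolded moment_topology_def]]
    by metis
  obtain p where p: "p \<in> mpolys k"
    and pq: "\<And>\<alpha>. \<alpha> \<in> multi_indices k \<Longrightarrow> Poly_Mapping.lookup p \<alpha> = q \<alpha>"
    using obtain_mpoly_with_coefficients by blast
  have "0 \<le> mpoly_eval p x" if "x \<in> K" for x
  proof -
    have "atomic_moments k {x} (\<lambda>_. 1) \<in> atomic_cone k K"
      using that unfolding atomic_cone_def by fastforce
    from q[OF this] show ?thesis
      by (simp add: mpoly_eval_eq_sum_multi_indices[OF p] atomic_moments_def pq)
  qed
  then have "0 \<le> riesz k y p"
    using pos p by (auto simp: K_positive_def)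
  then show False
    using qy by (simp add: riesz_def pq)
qed

theorem theorem2p2:
  fixes K :: "(real ^ 'n) set" and k :: nat and y :: "nat ^ 'n \<Rightarrow> real"
  assumes "1 \<le> k" and "closed K" and "y \<in> moment_space k"
  shows "(K_positive k K (riesz k y) \<longleftrightarrow>
            y \<in> moment_topology k closure_of atomic_representable k K) \<and>
         (y \<in> moment_topology k closure_of atomic_representable k K \<longleftrightarrow>
            y \<in> moment_topology k closure_of representable k K)"
proof -
  have "y \<in> moment_topology k closure_of atomic_representable k K"
    if "K_positive k K (riesz k y)"
    using K_positive_imp_in_closure[OF that assms(3)]
      closure_of_mono[OF atomic_cone_subset_atomic_representable] by blast
  moreover have "y \<in> moment_topology k closure_of representable k K"
    if "y \<in> moment_topology k closure_of atomic_representable k K"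
  proof -
    have "atomic_representable k K \<subseteq> representable k K"
      by (auto simp: atomic_representable_def representable_def)
    then show ?thesis
      using that closure_of_mono by blast
  qed
  ultimately show ?thesis
    using K_positive_if_in_closure[OF assms(2)] by blast
qed

end
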